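(* Let $P=P(A,a,b,b_a)$ be a lattice-free simplex with $|\det A|=\delta$, where $\delta=\delta\begin{pmatrix}A\\ a^T\end{pmatrix}$. Then $$w(P)<\left\lfloor\frac{\delta}{2}\right\rfloor.$$
   Context: Simplex: let $A\in\mathbb{Z}^{n\times n}$ be invertible, $b\in\mathbb{Z}^n$, $v$ the solution of $Av=b$, $C(A)=\{x\in\mathbb{R}^n: Ax\ge 0\}$ with dual cone $C(A)^*=\{x\in\mathbb{R}^n: y^Tx\ge 0\ \forall y\in C(A)\}$, let $a\in\mathbb{Z}^n$ with $-a\in\operatorname{int}(C(A)^* )$, and let $b_a$ be an integer with $b_a>a^Tv$. Then $P(A,a,b,b_a)=\{x\in\mathbb{R}^n: Ax\le b,\ a^Tx\le b_a\}$ is an $n$-dimensional simplex. It is lattice-free if it contains no point of $\mathbb{Z}^n$. For an integer matrix $M$ with $n$ columns and at least $n$ rows, $\delta(M)$ is the minimum of $|\det N|$ over all invertible $n\times n$ submatrices $N$ of $M$. Lattice width: $w(P)=\min_{z\in\mathbb{Z}^n\setminus\{0\}}\big(\max_{x\in P}z^Tx-\min_{y\in P}z^Ty\big)$. *)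

theory Defs
  imports "HOL-Analysis.Analysis"
begin

definition real_vec :: "int^'n \<Rightarrow> real^'n"
  where "real_vec u = (\<chi> i. real_of_int (u $ i))"

abbreviation real_mat :: "int^'n^'m \<Rightarrow> real^'n^'m"
  where "real_mat \<equiv> map_matrix real_of_int"

text \<open>
  Matrix inequalities such as \<open>A *v x \<le> b\<close> use the library order on \<open>real^'n\<close>, which is
  componentwise.
\<close>

definition ineq_cone :: "int^'n^'n \<Rightarrow> (real^'n) set"
  where "ineq_cone A = {x. real_mat A *v x \<ge> 0}"

definition dual_cone :: "(real^'n) set \<Rightarrow> (real^'n) set"
  where "dual_cone C = {x. \<forall>y\<in>C. y \<bullet> x \<ge> 0}"

definition simplex_P :: "int^'n^'n \<Rightarrow> int^'n \<Rightarrow> int^'n \<Rightarrow> int \<Rightarrow> (real^'n) set"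
  where "simplex_P A a b ba =
    {x. real_mat A *v x \<le> real_vec b \<and> real_vec a \<bullet> x \<le> real_of_int ba}"

definition lattice_free :: "(real^'n) set \<Rightarrow> bool"
  where "lattice_free P \<longleftrightarrow> P \<inter> range real_vec = {}"

definition append_row :: "int^'n^'m \<Rightarrow> int^'n \<Rightarrow> int^'n^('m option)"
  where "append_row A a = (\<chi> i. case i of Some j \<Rightarrow> A $ j | None \<Rightarrow> a)"

text \<open>
  A square submatrix takes all columns and \<open>CARD('n)\<close> distinct rows, chosen by an injection \<open>r\<close>.
  Index types carry no order, so every arrangement of the chosen rows is allowed; this changes
  the determinant only by its sign. Invertibility is over the reals: \<open>invertible\<close> at type
  \<open>int\<close> would mean unimodular.
\<close>

definition row_submatrix :: "int^'n^'m \<Rightarrow> ('n \<Rightarrow> 'm) \<Rightarrow> int^'n^'n"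
  where "row_submatrix M r = (\<chi> i. M $ (r i))"

definition min_subdet :: "int^'n^'m \<Rightarrow> int"
  where "min_subdet M =
    Min {\<bar>det (row_submatrix M r)\<bar> | r. inj r \<and> invertible (real_mat (row_submatrix M r))}"

text \<open>
  For nonempty compact \<open>P\<close> the supremum and the infimum over \<open>P\<close> are attained, and for
  full-dimensional \<open>P\<close> so is the outer infimum, so for simplices these are the maxima and
  minima of the usual definition.
\<close>

definition width_along :: "(real^'n) set \<Rightarrow> real^'n \<Rightarrow> real"
  where "width_along P z = (SUP x\<in>P. z \<bullet> x) - (INF y\<in>P. z \<bullet> y)"

definition lattice_width :: "(real^'n) set \<Rightarrow> real"
  where "lattice_width P = (INF z\<in>-{0}. width_along P (real_vec z))"

end

theory Submission
  imports Defs
begin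

text \<open>
  Write \<open>- a = lam v* A\<close>; the cone condition says exactly that all \<open>lam $ i\<close> are positive
  (\<open>facet_multipliers\<close>). In the slack coordinates \<open>y = b - A x\<close> the simplex becomes
  \<open>{y. 0 \<le> y \<and> lam \<bullet> y \<le> \<beta>}\<close> with \<open>\<beta> = ba - a \<bullet> v > 0\<close>, and the integer points become the coset
  \<open>b + L\<close> of the lattice \<open>L = A \<int>\<^sup>n\<close>. So the simplex is lattice-free exactly when every nonnegative
  representative of \<open>b\<close> modulo \<open>L\<close> has weight \<open>lam \<bullet> y\<close> above \<open>\<beta>\<close>. A volume argument shows that \<open>L\<close>
  has index at most \<open>\<delta> = \<bar>det A\<bar>\<close> (\<open>card_incongruent_le_det\<close>).

  Take a nonnegative representative \<open>y\<close> of \<open>b\<close> of least weight and, among these, of largest Euclidean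
  norm. Then no nonzero lattice vector fits into the box \<open>[-y, y]\<close> (\<open>extremal_representative\<close>), so the
  \<open>\<Prod>(1 + y\<^sub>i)\<close> integer points of \<open>[0, y]\<close> are pairwise incongruent, and this product is at most \<open>\<delta>\<close>.
  The weight bound \<open>\<beta> < lam \<bullet> y\<close> turns information about \<open>y\<close> into bounds on the width.

  If \<open>\<Sum>y\<^sub>i \<le> \<delta> div 2\<close>, the row of \<open>A\<close> with the largest multiplier is a good direction: the width along
  it is \<open>\<beta> / lam\<^sub>i < \<Sum>y\<^sub>i\<close>. Otherwise the product bound forces \<open>y = k e\<^sub>i\<close> with \<open>k > \<delta> div 2\<close>
  (\<open>concentrated\<close>), and then the multiples of \<open>e\<^sub>i\<close> already use up more than half of \<open>\<int>\<^sup>n / L\<close>; hence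
  \<open>e\<^sub>i\<close> generates this group, with some order \<open>r \<le> \<delta>\<close> (\<open>cyclic_quotient\<close>). Writing \<open>e\<^sub>j\<close> as \<open>h\<^sub>j e\<^sub>i\<close>
  modulo \<open>L\<close>, the vector \<open>u = h / r\<close> pairs integrally with \<open>L\<close>, so \<open>u v* A\<close> is an integer direction.
  Exchanging copies of \<open>e\<^sub>i\<close> for copies of \<open>e\<^sub>j\<close> cannot lower the weight of \<open>k e\<^sub>i\<close>, and for suitable
  residues \<open>h\<^sub>j\<close> this makes \<open>u\<close> so small compared with \<open>lam\<close> (\<open>coordinate_coefficient\<close>) that the
  width is below \<open>max (k / r) (k / 3)\<close>, which is at most \<open>\<delta> div 2\<close>.
\<close>

section \<open>Integer vectors as real vectors\<close>

lemma real_vec_nth [simp]: "real_vec u $ i = real_of_int (u $ i)"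
  by (simp add: real_vec_def)

lemma real_vec_diff: "real_vec (u - w) = real_vec u - real_vec w"
  by (simp add: vec_eq_iff)

lemma real_vec_matrix_vector_mult: "real_vec (A *v x) = real_mat A *v real_vec x"
  by (simp add: vec_eq_iff matrix_vector_mult_def)

lemma real_vec_inj: "real_vec u = real_vec w \<longleftrightarrow> u = w"
  by (simp add: vec_eq_iff)

lemma det_real_mat: "det (real_mat A) = real_of_int (det A)"
  by (simp add: det_def)

section \<open>The determinant bounds the index of a lattice\<close>

definition floor_vec :: "real^'n \<Rightarrow> int^'n"
  where "floor_vec x = (\<chi> i. \<lfloor>x $ i\<rfloor>)"

lemma floor_vec_nth [simp]: "floor_vec x $ i = \<lfloor>x $ i\<rfloor>"
  by (simp add: floor_vec_def)

lemma floor_vec_add_real_vec: "floor_vec (x + real_vec u) = floor_vec x + u"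
  by (simp add: vec_eq_iff)

lemma floor_vec_fibre_borel:
  fixes f :: "real^'n \<Rightarrow> real^'n"
  assumes "continuous_on UNIV f"
  shows "{x. floor_vec (f x) = m} \<in> sets borel"
proof -
  have *: "{x. floor_vec (f x) = m} = (\<Inter>i. {x. f x $ i \<in> {real_of_int (m $ i)..<real_of_int (m $ i) + 1}})"
    by (auto simp: vec_eq_iff floor_eq_iff)
  have "{x. f x $ i \<in> {real_of_int (m $ i)..<real_of_int (m $ i) + 1}} \<in> sets borel" for i
  proof -
    have "(\<lambda>x. f x $ i) \<in> borel_measurable borel"
      using assms by (intro borel_measurable_continuous_onI continuous_intros)
    from measurable_sets[OF this, of "{real_of_int (m $ i)..<real_of_int (m $ i) + 1}"]
    show ?thesis by (simp add: vimage_def)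
  qed
  then show ?thesis
    unfolding * by (intro sets.countable_INT') auto
qed

lemma emeasure_unit_cell:
  "emeasure lborel {x :: real^'n. floor_vec x = m} = 1"
proof (rule antisym)
  let ?l = "real_vec m" and ?u = "real_vec m + 1 :: real^'n"
  have sub1: "{x. floor_vec x = m} \<subseteq> cbox ?l ?u"
   and sub2: "box ?l ?u \<subseteq> {x. floor_vec x = m}"
    by (auto simp: vec_eq_iff mem_box_cart floor_eq_iff less_imp_le)
  have [measurable]: "{x::real^'n. floor_vec x = m} \<in> sets borel"
    using floor_vec_fibre_borel[of "\<lambda>x. x"] by simp
  have *: "(\<Prod>b\<in>Basis. (?u - ?l) \<bullet> b) = 1"
    by (rule prod.neutral) (auto simp: Basis_vec_def inner_axis)
  have "?l \<bullet> b \<le> ?u \<bullet> b" if "b \<in> Basis" for b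
    using that by (auto simp: Basis_vec_def inner_axis)
  then have "emeasure lborel (cbox ?l ?u) = 1" "emeasure lborel (box ?l ?u) = 1"
    using * by (simp_all add: emeasure_lborel_cbox_eq emeasure_lborel_box_eq)
  then show "emeasure lborel {x. floor_vec x = m} \<le> 1" "1 \<le> emeasure lborel {x. floor_vec x = m}"
    using emeasure_mono[OF sub1, of lborel] emeasure_mono[OF sub2, of lborel] by auto
qed

text \<open>
  Cut the union \<open>T\<close> of the unit cells at the points of \<open>S\<close> along the tiling of space by the translates
  of the parallelepiped \<open>D = A [0,1)\<^sup>n\<close>, and move each piece into \<open>D\<close> by its lattice vector. Because the
  points of \<open>S\<close> are incongruent modulo the lattice, the moved pieces stay disjoint, so the volume \<open>card S\<close>
  of \<open>T\<close> is at most the volume \<open>\<bar>det A\<bar>\<close> of \<open>D\<close>.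
\<close>

lemma card_incongruent_le_det_wellorder:
  fixes A :: "int^'n::{finite,wellorder}^'n::_"
  assumes "invertible (real_mat A)" and "finite S"
    and incong: "\<And>s t. s \<in> S \<Longrightarrow> t \<in> S \<Longrightarrow> s - t \<in> range ((*v) A) \<Longrightarrow> s = t"
  shows "int (card S) \<le> \<bar>det A\<bar>"
proof -
  define R where "R = real_mat A"
  obtain R' where "R ** R' = mat 1" "R' ** R = mat 1"
    using assms(1) unfolding R_def invertible_def by blast
  then have RR: "R *v (R' *v x) = x" and R'R: "R' *v (R *v x) = x" for x
    by (simp_all add: matrix_vector_mul_assoc)
  have cont: "continuous_on UNIV ((*v) R')"
    by (simp add: linear_continuous_on matrix_vector_mul_bounded_linear)
  define T where "T = {x :: (real, 'n) vec. floor_vec x \<in> S}"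
  \<comment> \<open>\<open>B m\<close> is the piece of \<open>T\<close> in the tile with index \<open>m\<close>, and \<open>C m\<close> is that piece moved into \<open>D\<close>.\<close>
  define B where "B m = {x \<in> T. floor_vec (R' *v x) = m}" for m
  define C where "C m = (+) (R *v real_vec m) -` B m" for m
  define D where "D = {x. floor_vec (R' *v x) = 0}"
  have T_Un: "T = (\<Union>s\<in>S. {x. floor_vec x = s})"
    by (auto simp: T_def)
  have cell: "{x :: (real, 'n) vec. floor_vec x = s} \<in> sets borel" for s
    using floor_vec_fibre_borel[of "\<lambda>x. x"] by simp
  have T_meas: "T \<in> sets borel"
    unfolding T_Un using assms(2) cell by (intro sets.finite_UN) auto
  have B_meas: "B m \<in> sets borel" for m
    using sets.Int[OF T_meas floor_vec_fibre_borel[OF cont, of m]] by (simp add: B_def Int_def)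
  have C_meas: "C m \<in> sets borel" for m
    using measurable_sets[OF _ B_meas, of "(+) (R *v real_vec m)" borel m] by (simp add: C_def)
  have D_meas: "D \<in> sets borel"
    unfolding D_def by (rule floor_vec_fibre_borel[OF cont])
  have C_eq: "emeasure lborel (C m) = emeasure lborel (B m)" for m
  proof -
    have "emeasure lborel (B m) = emeasure (distr lborel borel ((+) (R *v real_vec m))) (B m)"
      by (simp add: lborel_distr_plus)
    also have "\<dots> = emeasure lborel (C m)"
      using B_meas by (subst emeasure_distr) (auto simp: C_def)
    finally show ?thesis by simp
  qed
  have CD: "(\<Union>m. C m) \<subseteq> D"
  proof -
    have "floor_vec (R' *v (x + R *v real_vec m)) = floor_vec (R' *v x) + m" for x m
      by (simp add: matrix_vector_right_distrib R'R floor_vec_add_real_vec)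
    then show ?thesis by (auto simp: C_def B_def D_def add.commute)
  qed
  \<comment> \<open>A common point of two moved pieces yields two points of \<open>T\<close> that differ by a lattice vector, which
    is integral; so their cells are congruent, hence equal.\<close>
  have disj: "disjoint_family C"
  proof (rule ccontr)
    assume "\<not> disjoint_family C"
    then obtain m m' x where "m \<noteq> m'" "x \<in> C m" "x \<in> C m'"
      by (auto simp: disjoint_family_on_def)
    then have S: "floor_vec (x + R *v real_vec m) \<in> S" "floor_vec (x + R *v real_vec m') \<in> S"
      by (auto simp: C_def B_def T_def add.commute)
    have eq: "floor_vec (x + R *v real_vec m) = floor_vec x + A *v m" for m
      by (simp add: R_def floor_vec_add_real_vec flip: real_vec_matrix_vector_mult)
    have "floor_vec x + A *v m - (floor_vec x + A *v m') \<in> range ((*v) A)"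
      by (simp add: matrix_vector_mult_diff_distrib[symmetric])
    with incong S eq have "A *v m = A *v m'" by fastforce
    then have "R *v real_vec m = R *v real_vec m'"
      by (simp add: R_def flip: real_vec_matrix_vector_mult)
    then have "m = m'" by (metis R'R real_vec_inj)
    with \<open>m \<noteq> m'\<close> show False by simp
  qed
  have "of_nat (card S) = (\<Sum>s\<in>S. emeasure lborel {x :: (real, 'n) vec. floor_vec x = s})"
    by (simp add: emeasure_unit_cell)
  also have "\<dots> = emeasure lborel T"
    unfolding T_Un using assms(2) cell
    by (intro sum_emeasure) (auto simp: disjoint_family_on_def)
  also have "T = (\<Union>m. B m)"
    by (auto simp: B_def)
  also have "emeasure lborel (\<Union>m. B m) = (\<integral>\<^sup>+ m. emeasure lborel (B m) \<partial>count_space UNIV)"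
    using B_meas by (intro emeasure_UN_countable) (auto simp: disjoint_family_on_def B_def)
  also have "\<dots> = (\<integral>\<^sup>+ m. emeasure lborel (C m) \<partial>count_space UNIV)"
    by (simp add: C_eq)
  also have "\<dots> = emeasure lborel (\<Union>m. C m)"
    using C_meas disj by (intro emeasure_UN_countable[symmetric]) auto
  also have "\<dots> \<le> emeasure lborel D"
    using CD D_meas by (intro emeasure_mono) auto
  also have "\<dots> = ennreal \<bar>det R\<bar>"
  proof -
    let ?Q = "{x :: (real, 'n) vec. floor_vec x = 0}"
    have Q_m: "?Q \<in> lmeasurable"
      using cell[of 0] by (intro fmeasurableI) (auto simp: emeasure_unit_cell)
    have D: "D = (*v) R ` ?Q"
      by (auto simp: D_def RR R'R intro!: image_eqI[of _ _ "R' *v _"])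
    have "D \<in> lmeasurable"
      unfolding D using Q_m by (intro measurable_linear_image) auto
    then have "emeasure lebesgue D = ennreal (measure lebesgue D)"
      by (rule emeasure_eq_measure2)
    then have "emeasure lborel D = ennreal (measure lebesgue D)"
      using D_meas by simp
    also have "measure lebesgue D = \<bar>det R\<bar> * measure lebesgue ?Q"
      unfolding D using Q_m by (subst measure_linear_image) auto
    also have "measure lebesgue ?Q = 1"
      using cell[of 0] by (simp add: measure_def emeasure_unit_cell)
    finally show ?thesis by simp
  qed
  finally have "ennreal (real (card S)) \<le> ennreal \<bar>det R\<bar>"
    by (simp add: ennreal_of_nat_eq_real_of_nat)
  then have "real (card S) \<le> \<bar>det R\<bar>" by simp
  then show ?thesis
    by (simp add: R_def det_real_mat flip: of_int_abs)
qed


text \<open>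
  The volume formula for linear images is stated for well-ordered index types. The type
  \<open>'n ordered_index\<close> is a well-ordered copy of \<open>'n\<close>; neither the determinant nor congruence modulo
  the lattice changes when the coordinates are renamed.
\<close>

lemma det_reindex:
  fixes A :: "'a::comm_ring_1^'n^'n" and g :: "'m::finite \<Rightarrow> 'n"
  assumes "bij g"
  shows "det (\<chi> i j. A $ g i $ g j) = det A"
proof -
  let ?conj = "\<lambda>p x. g (p (inv g x))"
  have "bij_betw ?conj {p. p permutes UNIV} {p. p permutes UNIV}"
    using bij_betw_permutations[OF assms] by simp
  then have "det A = (\<Sum>p | p permutes UNIV. of_int (sign (?conj p)) * (\<Prod>i\<in>UNIV. A $ i $ ?conj p i))"
    unfolding det_def by (rule sum.reindex_bij_betw[symmetric])
  also have "\<dots> = (\<Sum>p | p permutes UNIV. of_int (sign p) * (\<Prod>i\<in>UNIV. A $ g i $ g (p i)))"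
  proof (rule sum.cong)
    fix p :: "'m \<Rightarrow> 'm" assume "p \<in> {p. p permutes UNIV}"
    then have p: "p permutes UNIV" by simp
    have "?conj p = map_permutation UNIV g p"
      using assms by (simp add: map_permutation_def restrict_id_def o_def bij_is_surj)
    then have "sign (?conj p) = sign p"
      using sign_map_permutation[OF bij_is_inj[OF assms] p] by simp
    moreover have "(\<Prod>i\<in>UNIV. A $ i $ ?conj p i) = (\<Prod>i\<in>UNIV. A $ g i $ ?conj p (g i))"
      by (rule prod.reindex_bij_betw[OF assms, symmetric])
    ultimately show "of_int (sign (?conj p)) * (\<Prod>i\<in>UNIV. A $ i $ ?conj p i) =
        of_int (sign p) * (\<Prod>i\<in>UNIV. A $ g i $ g (p i))"
      using assms by (simp add: bij_is_inj)
  qed simp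
  finally show ?thesis by (simp add: det_def)
qed

typedef 'n ordered_index = "{..<CARD('n::finite)}"
  by (auto intro!: exI[of _ 0])

instance ordered_index :: (finite) finite
proof
  show "finite (UNIV :: 'a ordered_index set)"
    unfolding type_definition.univ[OF type_definition_ordered_index] by simp
qed

instantiation ordered_index :: (finite) linorder
begin

definition "x \<le> y \<longleftrightarrow> Rep_ordered_index x \<le> Rep_ordered_index y"
definition "x < y \<longleftrightarrow> Rep_ordered_index x < Rep_ordered_index y"

instance
  by intro_classes
    (auto simp: less_eq_ordered_index_def less_ordered_index_def Rep_ordered_index_inject)

end

instance ordered_index :: (finite) wellorder
proof
  fix P :: "'a ordered_index \<Rightarrow> bool" and a
  assume step: "\<And>x. (\<And>y. y < x \<Longrightarrow> P y) \<Longrightarrow> P x"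
  show "P a"
  proof (induction a rule: measure_induct_rule[of Rep_ordered_index])
    case (less x)
    show ?case
      by (rule step, rule less.IH) (simp only: less_ordered_index_def)
  qed
qed

lemma ex_bij_ordered_index: "\<exists>g :: 'n::finite ordered_index \<Rightarrow> 'n. bij g"
proof -
  have "card (UNIV :: 'n ordered_index set) = CARD('n)"
    unfolding type_definition.univ[OF type_definition_ordered_index]
    by (subst card_image) (auto simp: inj_on_def Abs_ordered_index_inject)
  then show ?thesis
    by (intro finite_same_card_bij) auto
qed

lemma card_incongruent_le_det:
  fixes A :: "int^'n^'n"
  assumes "det A \<noteq> 0" and "finite S"
    and incong: "\<And>s t. s \<in> S \<Longrightarrow> t \<in> S \<Longrightarrow> s - t \<in> range ((*v) A) \<Longrightarrow> s = t"
  shows "int (card S) \<le> \<bar>det A\<bar>"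
proof -
  obtain g :: "'n ordered_index \<Rightarrow> 'n" where g: "bij g"
    using ex_bij_ordered_index by blast
  define B where "B = (\<chi> i j. A $ g i $ g j)"
  define \<rho> where "\<rho> x = (\<chi> i. x $ g i)" for x :: "int^'n"
  have \<rho>_eq_iff: "\<rho> x = \<rho> y \<longleftrightarrow> x = y" for x y
    unfolding \<rho>_def vec_eq_iff using g by (metis bij_pointE vec_lambda_beta)
  have \<rho>_surj: "\<exists>x. y = \<rho> x" for y
    using g by (intro exI[of _ "\<chi> i. y $ inv g i"]) (simp add: \<rho>_def vec_eq_iff bij_is_inj)
  have \<rho>_mult: "B *v \<rho> x = \<rho> (A *v x)" for x
    unfolding \<rho>_def B_def matrix_vector_mult_def vec_eq_iff
    by (auto intro!: sum.reindex_bij_betw[OF g, of "\<lambda>j. A $ _ $ j * x $ j"])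
  have \<rho>_diff: "\<rho> x - \<rho> y = \<rho> (x - y)" for x y
    by (simp add: \<rho>_def vec_eq_iff)
  have det_B: "det B = det A"
    unfolding B_def by (rule det_reindex[OF g])
  have "int (card (\<rho> ` S)) \<le> \<bar>det B\<bar>"
  proof (rule card_incongruent_le_det_wellorder)
    show "invertible (real_mat B)"
      using assms(1) det_B by (simp add: invertible_det_nz det_real_mat)
  next
    fix s t assume "s \<in> \<rho> ` S" "t \<in> \<rho> ` S" "s - t \<in> range ((*v) B)"
    then obtain s' t' y where "s = \<rho> s'" "t = \<rho> t'" "s' \<in> S" "t' \<in> S" "s - t = B *v y"
      by blast
    moreover obtain x where "y = \<rho> x" using \<rho>_surj by blast
    ultimately have *: "s = \<rho> s'" "t = \<rho> t'" "s' \<in> S" "t' \<in> S" "s - t = B *v \<rho> x"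
      by auto
    then have "s' - t' \<in> range ((*v) A)"
      by (auto simp: \<rho>_mult \<rho>_diff \<rho>_eq_iff)
    with * incong show "s = t" by blast
  qed (use assms in auto)
  moreover have "card (\<rho> ` S) = card S"
    by (rule card_image) (simp add: inj_on_def \<rho>_eq_iff)
  ultimately show ?thesis by (simp add: det_B)
qed

section \<open>Counting in boxes\<close>

lemma card_vec_box:
  fixes F :: "'n::finite \<Rightarrow> 'a set"
  assumes "\<And>i. finite (F i)"
  shows "finite {y :: 'a^'n. \<forall>i. y $ i \<in> F i}"
    and "card {y :: 'a^'n. \<forall>i. y $ i \<in> F i} = (\<Prod>i\<in>UNIV. card (F i))"
proof -
  have bij: "bij_betw vec_lambda (PiE UNIV F) {y :: 'a^'n. \<forall>i. y $ i \<in> F i}"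
    by (rule bij_betw_byWitness[of _ vec_nth]) (auto simp: PiE_def)
  show "finite {y :: 'a^'n. \<forall>i. y $ i \<in> F i}"
    using bij_betw_finite[OF bij] assms by (auto intro: finite_PiE)
  show "card {y :: 'a^'n. \<forall>i. y $ i \<in> F i} = (\<Prod>i\<in>UNIV. card (F i))"
    using bij_betw_same_card[OF bij] by (simp add: card_PiE)
qed

lemma one_plus_sum_le_prod:
  fixes y :: "'a \<Rightarrow> int"
  assumes "finite I" "\<And>i. i \<in> I \<Longrightarrow> 0 \<le> y i"
  shows "1 + sum y I \<le> (\<Prod>i\<in>I. 1 + y i)"
  using assms
proof (induction I rule: finite_induct)
  case (insert x I)
  have "0 \<le> sum y I" using insert.prems by (intro sum_nonneg) auto
  then have "1 + (y x + sum y I) \<le> (1 + y x) * (1 + sum y I)"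
    using insert.prems by (simp add: algebra_simps)
  also have "\<dots> \<le> (1 + y x) * (\<Prod>i\<in>I. 1 + y i)"
    using insert by (intro mult_left_mono) auto
  finally show ?case using insert by simp
qed simp

section \<open>Extremal representatives modulo a lattice\<close>

text \<open>
  A subgroup \<open>L\<close> of \<open>\<int>\<^sup>n\<close> of index at most \<open>\<delta>\<close>. Bounding families of incongruent points is the only
  form in which the index enters, and it avoids quotient groups.
\<close>

locale index_bounded_lattice =
  fixes L :: "(int^'n) set" and \<delta> :: int
  assumes zero_mem: "0 \<in> L"
    and diff_mem: "s \<in> L \<Longrightarrow> t \<in> L \<Longrightarrow> s - t \<in> L"
    and index_le: "finite S \<Longrightarrow> (\<And>s t. s \<in> S \<Longrightarrow> t \<in> S \<Longrightarrow> s - t \<in> L \<Longrightarrow> s = t) \<Longrightarrow>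
      int (card S) \<le> \<delta>"
begin

lemma uminus_mem: "s \<in> L \<Longrightarrow> - s \<in> L"
  using diff_mem[OF zero_mem] by fastforce

lemma add_mem: "s \<in> L \<Longrightarrow> t \<in> L \<Longrightarrow> s + t \<in> L"
  using diff_mem[OF _ uminus_mem] by fastforce

lemma smult_mem:
  assumes "s \<in> L" shows "c *s s \<in> L"
proof (induction c rule: int_induct[where k = 0])
  case base
  then show ?case using zero_mem by simp
next
  case (step1 i)
  then show ?case using add_mem[OF _ assms] by simp
next
  case (step2 i)
  then show ?case using diff_mem[OF _ assms] by simp
qed

lemma sum_mem: "(\<And>i. i \<in> I \<Longrightarrow> f i \<in> L) \<Longrightarrow> sum f I \<in> L"
  by (induction I rule: infinite_finite_induct) (auto intro: zero_mem add_mem)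

lemma card_incongruent_family_le:
  assumes "finite I" "\<And>i j. i \<in> I \<Longrightarrow> j \<in> I \<Longrightarrow> f i - f j \<in> L \<Longrightarrow> i = j"
  shows "int (card I) \<le> \<delta>"
proof -
  have "inj_on f I"
    using assms(2) zero_mem by (auto simp: inj_on_def)
  moreover have "int (card (f ` I)) \<le> \<delta>"
    using assms by (intro index_le) auto
  ultimately show ?thesis by (simp add: card_image)
qed

lemma index_pos: "1 \<le> \<delta>"
  using index_le[of "{0}"] by simp

text \<open>
  Pigeonhole: two of the \<open>\<delta> + 1\<close> multiples \<open>0 v, \<dots>, \<delta> v\<close> are congruent.
\<close>

lemma multiple_mem:
  obtains r where "1 \<le> r" "r \<le> \<delta>" "r *s v \<in> L"
proof -
  have "\<exists>r\<ge>1. r \<le> \<delta> \<and> r *s v \<in> L"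
  proof (rule ccontr)
    assume *: "\<not> ?thesis"
    have no: "\<not> m < m'" if "m \<in> {0..\<delta>}" "m' \<in> {0..\<delta>}" "m' *s v - m *s v \<in> L" for m m'
    proof
      assume "m < m'"
      moreover have "(m' - m) *s v \<in> L" using that(3) by simp
      ultimately show False using * that(1,2) by (auto dest!: spec[of _ "m' - m"])
    qed
    have "int (card {0..\<delta>}) \<le> \<delta>"
    proof (rule card_incongruent_family_le[where f = "\<lambda>m. m *s v"])
      fix m m' assume "m \<in> {0..\<delta>}" "m' \<in> {0..\<delta>}" and mem: "m *s v - m' *s v \<in> L"
      then show "m = m'"
        using no[of m m'] no[of m' m] uminus_mem[OF mem] by (auto simp: not_less)
    qed simp
    then show False using index_pos by simp
  qed
  then show ?thesis using that by blast
qed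

lemma nonneg_representative: "\<exists>y\<ge>0. b - y \<in> L"
proof -
  obtain r where r: "1 \<le> r" "r *s (1 :: int^'n) \<in> L"
    using multiple_mem by blast
  define N where "N = (\<Sum>i\<in>UNIV. \<bar>b $ i\<bar>)"
  define y where "y = b + (N * r) *s 1"
  have "0 \<le> y $ i" for i
  proof -
    have "\<bar>b $ i\<bar> \<le> N" unfolding N_def by (rule member_le_sum) auto
    also have "N * 1 \<le> N * r" unfolding N_def using r(1) by (intro mult_left_mono sum_nonneg) auto
    finally show ?thesis by (simp add: y_def)
  qed
  moreover have "b - y \<in> L"
    using uminus_mem[OF smult_mem[OF r(2), of N]] by (simp add: y_def)
  ultimately show ?thesis by (auto simp: less_eq_vec_def)
qed

text \<open>
  If a lattice vector \<open>d\<close> fits into the box \<open>[-y, y]\<close>, then \<open>y + d\<close> and \<open>y - d\<close> are nonnegative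
  representatives as well, and \<open>y\<close> is their midpoint. Minimality of the weight only forces both to
  have the same weight as \<open>y\<close>. Maximality of the convex function \<open>q\<close> among the representatives of
  least weight breaks the tie and forces \<open>d = 0\<close>.
\<close>

lemma extremal_representative:
  fixes lam :: "real^'n"
  assumes lam: "\<And>i. 0 < lam $ i"
  obtains y where "0 \<le> y" "b - y \<in> L"
    "\<And>y'. 0 \<le> y' \<Longrightarrow> b - y' \<in> L \<Longrightarrow> lam \<bullet> real_vec y \<le> lam \<bullet> real_vec y'"
    "\<And>d. d \<in> L \<Longrightarrow> (\<And>i. \<bar>d $ i\<bar> \<le> y $ i) \<Longrightarrow> d = 0"
proof -
  obtain y0 where y0: "0 \<le> y0" "b - y0 \<in> L"
    using nonneg_representative by blast
  define w where "w y = lam \<bullet> real_vec y" for y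
  define F where "F = {y. 0 \<le> y \<and> b - y \<in> L \<and> w y \<le> w y0}"
  have "F \<subseteq> {y. \<forall>i. y $ i \<in> {0..\<lceil>w y0 / lam $ i\<rceil>}}"
  proof safe
    fix y i assume y: "y \<in> F"
    then have nn: "0 \<le> y $ j" for j by (simp add: F_def less_eq_vec_def)
    have "lam $ i * y $ i \<le> (\<Sum>j\<in>UNIV. lam $ j * y $ j)"
      using nn lam by (intro member_le_sum) (auto simp: less_imp_le)
    also have "\<dots> = w y" by (simp add: w_def inner_vec_def real_vec_def)
    also have "\<dots> \<le> w y0" using y by (simp add: F_def)
    finally have "real_of_int (y $ i) \<le> w y0 / lam $ i"
      using lam by (simp add: pos_le_divide_eq mult.commute)
    also have "\<dots> \<le> real_of_int \<lceil>w y0 / lam $ i\<rceil>"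
      by (rule le_of_int_ceiling)
    finally have "y $ i \<le> \<lceil>w y0 / lam $ i\<rceil>" by (simp only: of_int_le_iff)
    then show "y $ i \<in> {0..\<lceil>w y0 / lam $ i\<rceil>}" using nn[of i] by simp
  qed
  then have fin: "finite F"
    by (rule finite_subset) (intro card_vec_box, simp)
  moreover have "F \<noteq> {}" using y0 by (auto simp: F_def)
  ultimately obtain y1 where "is_arg_min w (\<lambda>y. y \<in> F) y1"
    using ex_is_arg_min_if_finite by blast
  then have y1: "y1 \<in> F" "\<And>y. y \<in> F \<Longrightarrow> w y1 \<le> w y"
    by (auto simp: is_arg_min_linorder)
  define q where "q y = (\<Sum>i\<in>UNIV. (y $ i)\<^sup>2)" for y :: "int^'n"
  have "finite {y \<in> F. w y = w y1}" "{y \<in> F. w y = w y1} \<noteq> {}"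
    using fin y1 by auto
  then obtain y where "is_arg_min (\<lambda>y. - q y) (\<lambda>y. y \<in> {y \<in> F. w y = w y1}) y"
    using ex_is_arg_min_if_finite by blast
  then have y: "y \<in> F" "w y = w y1" "\<And>y'. y' \<in> F \<Longrightarrow> w y' = w y1 \<Longrightarrow> q y' \<le> q y"
    by (auto simp: is_arg_min_linorder)
  have min: "w y \<le> w y'" if "0 \<le> y'" "b - y' \<in> L" for y'
  proof (cases "w y' \<le> w y0")
    case True
    then show ?thesis using that y y1 by (simp add: F_def)
  next
    case False
    then show ?thesis using y(1) by (simp add: F_def)
  qed
  have ext: "d = 0" if d: "d \<in> L" "\<And>i. \<bar>d $ i\<bar> \<le> y $ i" for d
  proof -
    have w_lin: "w (y + d) + w (y - d) = 2 * w y"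
      by (simp add: w_def real_vec_def inner_vec_def sum.distrib[symmetric] sum_distrib_left algebra_simps)
    have nn: "0 \<le> y + d" "0 \<le> y - d"
    proof -
      have "0 \<le> y $ i + d $ i \<and> 0 \<le> y $ i - d $ i" for i
        using d(2)[of i] by linarith
      then show "0 \<le> y + d" "0 \<le> y - d" by (simp_all add: less_eq_vec_def)
    qed
    have b_d: "b - (y + d) \<in> L" "b - (y - d) \<in> L"
    proof -
      have "b - y \<in> L" using y(1) by (simp add: F_def)
      from diff_mem[OF this d(1)] add_mem[OF this d(1)]
      show "b - (y + d) \<in> L" "b - (y - d) \<in> L" by (simp_all add: algebra_simps)
    qed
    have "w (y + d) = w y" "w (y - d) = w y"
      using min[OF nn(1) b_d(1)] min[OF nn(2) b_d(2)] w_lin by linarith+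
    then have "q (y + d) \<le> q y" "q (y - d) \<le> q y"
      using y nn b_d by (auto simp: F_def)
    moreover have "q (y + d) + q (y - d) = 2 * q y + 2 * q d"
      by (simp add: q_def sum.distrib[symmetric] sum_distrib_left power2_eq_square algebra_simps)
    ultimately have "q d \<le> 0" by linarith
    have "d $ i = 0" for i
    proof -
      have "(d $ i)\<^sup>2 \<le> q d" unfolding q_def by (rule member_le_sum) auto
      then have "(d $ i)\<^sup>2 \<le> 0" using \<open>q d \<le> 0\<close> by (rule order_trans)
      then show ?thesis by simp
    qed
    then show "d = 0" by (simp add: vec_eq_iff)
  qed
  show thesis
    using that[of y] y(1) min ext by (simp add: F_def w_def)
qed

text \<open>
  The differences of points of \<open>[0, y]\<close> lie in \<open>[-y, y]\<close>, so these points are pairwise incongruent.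
\<close>

lemma prod_le_index:
  assumes "0 \<le> y" and free: "\<And>d. d \<in> L \<Longrightarrow> (\<And>i. \<bar>d $ i\<bar> \<le> y $ i) \<Longrightarrow> d = 0"
  shows "(\<Prod>i\<in>UNIV. 1 + y $ i) \<le> \<delta>"
proof -
  let ?box = "{s :: int^'n. \<forall>i. s $ i \<in> {0..y $ i}}"
  have "int (card ?box) \<le> \<delta>"
  proof (rule index_le)
    fix s t assume st: "s \<in> ?box" "t \<in> ?box" "s - t \<in> L"
    have "\<bar>(s - t) $ i\<bar> \<le> y $ i" for i
    proof -
      have "s $ i \<in> {0..y $ i}" "t $ i \<in> {0..y $ i}" using st by blast+
      then show ?thesis by auto
    qed
    with free[OF st(3)] show "s = t" by simp
  qed (intro card_vec_box, simp)
  moreover have "int (card ?box) = (\<Prod>i\<in>UNIV. 1 + y $ i)"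
    using assms(1) by (subst card_vec_box) (auto simp: less_eq_vec_def intro!: prod.cong)
  ultimately show ?thesis by simp
qed

text \<open>
  Split off one nonzero coordinate \<open>p\<close> and let \<open>q\<close> be the sum of the others. If \<open>q \<ge> 1\<close> then
  \<open>2 (p + q) \<le> (1 + p) (1 + q) \<le> \<Prod>(1 + y\<^sub>j) \<le> \<delta>\<close>, because \<open>(p - 1) (q - 1) \<ge> 0\<close>; this contradicts
  \<open>p + q > \<delta> div 2\<close>.
\<close>

lemma concentrated:
  assumes "0 \<le> y" and free: "\<And>d. d \<in> L \<Longrightarrow> (\<And>i. \<bar>d $ i\<bar> \<le> y $ i) \<Longrightarrow> d = 0"
    and large: "\<delta> div 2 < (\<Sum>i\<in>UNIV. y $ i)"
  obtains i k where "y = axis i k" "\<delta> div 2 < k"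
proof -
  have nn: "0 \<le> y $ i" for i using assms(1) by (simp add: less_eq_vec_def)
  have "\<exists>i. y $ i \<noteq> 0"
  proof (rule ccontr)
    assume "\<not> ?thesis"
    then have "(\<Sum>i\<in>UNIV. y $ i) = 0" by simp
    with large index_pos show False by linarith
  qed
  then obtain i where i: "y $ i \<noteq> 0" by blast
  define p where "p = y $ i"
  define q where "q = (\<Sum>j\<in>UNIV - {i}. y $ j)"
  have p: "1 \<le> p" using i nn[of i] by (simp add: p_def)
  have pq: "(\<Sum>i\<in>UNIV. y $ i) = p + q"
    unfolding p_def q_def by (subst sum.remove[of _ i]) auto
  have q0: "0 \<le> q" unfolding q_def using nn by (intro sum_nonneg) auto
  have "q = 0"
  proof (rule ccontr)
    assume "q \<noteq> 0"
    with q0 have q: "1 \<le> q" by simp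
    have "0 \<le> (p - 1) * (q - 1)" using p q by (intro mult_nonneg_nonneg) auto
    then have "2 * (p + q) \<le> (1 + p) * (1 + q)" by (simp add: algebra_simps)
    also have "\<dots> \<le> (1 + p) * (\<Prod>j\<in>UNIV - {i}. 1 + y $ j)"
      using p nn one_plus_sum_le_prod[of "UNIV - {i}" "\<lambda>j. y $ j"]
      by (intro mult_left_mono) (auto simp: q_def)
    also have "\<dots> = (\<Prod>j\<in>UNIV. 1 + y $ j)"
      unfolding p_def by (subst (2) prod.remove[of _ i]) auto
    also have "\<dots> \<le> \<delta>" by (rule prod_le_index[OF assms(1) free])
    finally have "2 * (p + q) \<le> \<delta>" .
    moreover have "\<delta> div 2 < p + q" using large pq by simp
    ultimately show False by presburger
  qed
  then have "\<forall>j\<in>UNIV - {i}. y $ j = 0"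
    unfolding q_def using nn by (subst (asm) sum_nonneg_eq_0_iff) auto
  then have "y = axis i p"
    by (auto simp: vec_eq_iff axis_def p_def)
  moreover have "\<delta> div 2 < p" using large pq \<open>q = 0\<close> by simp
  ultimately show thesis using that by blast
qed

text \<open>
  The order \<open>r\<close> of \<open>e\<^sub>i\<close> modulo \<open>L\<close> exceeds \<open>k\<close>, hence \<open>2 r > \<delta>\<close>. If some \<open>e\<^sub>j\<close> were not a multiple of
  \<open>e\<^sub>i\<close> modulo \<open>L\<close>, the cyclic group of \<open>e\<^sub>i\<close> and its coset through \<open>e\<^sub>j\<close> would give \<open>2 r\<close> incongruent
  points.
\<close>

lemma cyclic_quotient:
  assumes free: "\<And>d. d \<in> L \<Longrightarrow> (\<And>j. \<bar>d $ j\<bar> \<le> axis i k $ j) \<Longrightarrow> d = 0"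
    and large: "\<delta> div 2 < k"
  obtains r where "k < r" "r \<le> \<delta>" "axis i r \<in> L" "\<And>m. axis i m \<in> L \<Longrightarrow> r dvd m"
    "\<And>j. \<exists>g. 0 \<le> g \<and> g < r \<and> axis j 1 - axis i g \<in> L"
proof -
  have ax: "c *s axis i m = axis i (c * m)" "axis i m + axis i m' = axis i (m + m')"
    "axis i m - axis i m' = axis i (m - m')" for c m m' :: int
    by (auto simp: vec_eq_iff axis_def)
  obtain r1 where r1: "1 \<le> r1" "r1 \<le> \<delta>" "axis i r1 \<in> L"
    using multiple_mem[of "axis i 1"] ax by auto
  define N where "N = (LEAST n. 0 < n \<and> axis i (int n) \<in> L)"
  define r where "r = int N"
  have ex: "0 < nat r1 \<and> axis i (int (nat r1)) \<in> L" using r1 by simp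
  have N: "0 < N" "axis i (int N) \<in> L"
    unfolding N_def using LeastI[of "\<lambda>n. 0 < n \<and> axis i (int n) \<in> L", OF ex] by auto
  have "N \<le> nat r1"
    unfolding N_def using ex by (rule Least_le)
  with r1 have r_le: "r \<le> \<delta>" by (simp add: r_def)
  have r_pos: "0 < r" and r_mem: "axis i r \<in> L" using N by (auto simp: r_def)
  have r_min: "r \<le> m" if "0 < m" "axis i m \<in> L" for m
    using Least_le[of "\<lambda>n. 0 < n \<and> axis i (int n) \<in> L" "nat m"] that
    unfolding r_def N_def by simp
  have dvd: "r dvd m" if "axis i m \<in> L" for m
  proof -
    have "axis i (m - (m div r) * r) \<in> L"
      using diff_mem[OF that smult_mem[OF r_mem, of "m div r"]] by (simp add: ax)
    then have "axis i (m mod r) \<in> L" by (simp add: minus_div_mult_eq_mod)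
    moreover have "0 \<le> m mod r" "m mod r < r" using r_pos by auto
    ultimately have "m mod r = 0" using r_min[of "m mod r"] by linarith
    then show ?thesis by auto
  qed
  have k0: "0 \<le> k" using large index_pos by linarith
  have "k < r"
  proof (rule ccontr)
    assume "\<not> k < r"
    then have "axis i r = (0 :: int^'n)"
      using r_pos k0 by (intro free[OF r_mem]) (auto simp: axis_def)
    then show False using r_pos by simp
  qed
  have gen: "\<exists>g. 0 \<le> g \<and> g < r \<and> axis j 1 - axis i g \<in> L" for j
  proof (rule ccontr)
    assume none: "\<not> ?thesis"
    have none': "axis j 1 - axis i g \<notin> L" for g
    proof
      assume "axis j 1 - axis i g \<in> L"
      note add_mem[OF this smult_mem[OF r_mem, of "g div r"]]
      moreover have "axis j 1 - axis i g + (g div r) *s axis i r = axis j 1 - axis i (g - g div r * r)"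
        by (simp add: vec_eq_iff axis_def)
      ultimately have "axis j 1 - axis i (g mod r) \<in> L" by (simp add: minus_div_mult_eq_mod)
      with none r_pos show False by auto
    qed
    have uniq: "m = m'" if "m \<in> {0..<r}" "m' \<in> {0..<r}" "axis i m - axis i m' \<in> L" for m m'
    proof -
      have "r dvd m - m'" using that(3) dvd by (simp add: ax)
      with that(1,2) show ?thesis
        by (metis atLeastLessThan_iff mod_eq_dvd_iff mod_pos_pos_trivial)
    qed
    let ?f = "\<lambda>(c :: bool, m). (if c then axis j 1 else 0) + axis i m"
    have "int (card ((UNIV :: bool set) \<times> {0..<r})) \<le> \<delta>"
    proof (rule card_incongruent_family_le[where f = ?f])
      fix p p' assume p: "p \<in> UNIV \<times> {0..<r}" "p' \<in> UNIV \<times> {0..<r}" and mem: "?f p - ?f p' \<in> L"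
      obtain c m c' m' where [simp]: "p = (c, m)" "p' = (c', m')" by fastforce
      have "c = c'"
      proof (rule ccontr)
        assume "c \<noteq> c'"
        then consider "c" "\<not> c'" | "\<not> c" "c'" by blast
        then show False
        proof cases
          case 1
          then have "?f p - ?f p' = axis j 1 - axis i (m' - m)"
            by (simp add: vec_eq_iff axis_def)
          with mem have "axis j 1 - axis i (m' - m) \<in> L" by metis
          with none' show False by blast
        next
          case 2
          then have "- (?f p - ?f p') = axis j 1 - axis i (m - m')"
            by (simp add: vec_eq_iff axis_def)
          with uminus_mem[OF mem] have "axis j 1 - axis i (m - m') \<in> L" by metis
          with none' show False by blast
        qed
      qed
      with mem have "axis i m - axis i m' \<in> L" by (auto split: if_splits)
      with uniq p have "m = m'" by auto
      with \<open>c = c'\<close> show "p = p'" by simp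
    qed simp
    then have "2 * r \<le> \<delta>" using r_pos by (simp add: card_cartesian_product)
    with \<open>k < r\<close> large show False by presburger
  qed
  show thesis using that[OF \<open>k < r\<close> r_le r_mem dvd gen] .
qed

section \<open>A dual vector along which the simplex is short\<close>

text \<open>
  The residue \<open>h\<close> is \<open>g\<close> if \<open>g \<le> k\<close>, and \<open>g - r\<close> otherwise. In the first case the representative
  \<open>e\<^sub>j + (k - g) e\<^sub>i\<close> of \<open>k e\<^sub>i\<close> weighs at least as much as \<open>k e\<^sub>i\<close>, which is the upper bound. In the
  second case put \<open>h' = r - g\<close>, so that \<open>h' < r - k\<close>. Trading \<open>m\<close> copies of \<open>e\<^sub>j\<close>, which stand for
  \<open>- m h' e\<^sub>i\<close>, against \<open>r e\<^sub>i \<equiv> 0\<close> gives the representative \<open>m e\<^sub>j + (k + m h' - r) e\<^sub>i\<close>. For the least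
  admissible \<open>m\<close>, the number \<open>s = m h'\<close> is still at most \<open>r - 3\<close>, and comparing weights yields
  \<open>h' lam\<^sub>i \<le> s / (r - s) lam\<^sub>j \<le> (r - 3) / 3 lam\<^sub>j\<close>.
\<close>

lemma coordinate_coefficient:
  fixes lam :: "real^'n"
  assumes lam: "\<And>j. 0 < lam $ j"
    and min: "\<And>y'. 0 \<le> y' \<Longrightarrow> axis i k - y' \<in> L \<Longrightarrow> real_of_int k * lam $ i \<le> lam \<bullet> real_vec y'"
    and k: "k < r" "r < 2 * k" and r: "axis i r \<in> L"
    and g: "0 \<le> g" "g < r" "axis j 1 - axis i g \<in> L"
  obtains h where "axis j 1 - axis i h \<in> L"
    "real_of_int h * lam $ i \<le> lam $ j"
    "- real_of_int h * lam $ i \<le> max 0 (real_of_int r / 3 - 1) * lam $ j"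
proof -
  have lam_axis: "lam \<bullet> real_vec (c *s axis j 1 + axis i t) = c * lam $ j + t * lam $ i" for c t :: int
  proof -
    have "real_vec (c *s axis j 1 + axis i t) = real_of_int c *\<^sub>R axis j 1 + real_of_int t *\<^sub>R axis i 1"
      by (simp add: vec_eq_iff real_vec_def axis_def)
    then show ?thesis by (simp add: inner_add_right inner_axis)
  qed
  \<comment> \<open>Replacing \<open>k e\<^sub>i\<close> by the congruent nonnegative vector \<open>c e\<^sub>j + t e\<^sub>i\<close> cannot lower the weight.\<close>
  have exchange: "k * lam $ i \<le> c * lam $ j + t * lam $ i"
    if "0 \<le> c" "0 \<le> t" "k - t = c * g + s * r" for c t s :: int
  proof -
    have "axis i k - (c *s axis j 1 + axis i t) = s *s axis i r - c *s (axis j 1 - axis i g)"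
      using that(3) by (auto simp: vec_eq_iff axis_def algebra_simps)
    also have "\<dots> \<in> L" using smult_mem[OF r, of s] smult_mem[OF g(3), of c] by (rule diff_mem)
    finally have "axis i k - (c *s axis j 1 + axis i t) \<in> L" .
    moreover have "0 \<le> c *s axis j 1 + axis i t"
      using that(1,2) by (auto simp: less_eq_vec_def axis_def)
    ultimately show ?thesis using min lam_axis by metis
  qed
  show thesis
  proof (cases "g \<le> k")
    case True
    show thesis
    proof (rule that[of g])
      show "real_of_int g * lam $ i \<le> lam $ j"
        using exchange[of 1 "k - g" 0] True by (simp add: algebra_simps)
      have "- real_of_int g * lam $ i \<le> 0" using g(1) lam[of i] by simp
      also have "0 \<le> max 0 (real_of_int r / 3 - 1) * lam $ j" using lam[of j] by simp
      finally show "- real_of_int g * lam $ i \<le> max 0 (real_of_int r / 3 - 1) * lam $ j" .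
    qed (rule g)
  next
    case False
    define h' where "h' = r - g"
    have h': "0 < h'" "h' \<le> r - k - 1" using False g by (auto simp: h'_def)
    \<comment> \<open>\<open>m\<close> is \<open>(r - k) / h'\<close> rounded up, the least \<open>m\<close> with \<open>k + m h' - r \<ge> 0\<close>.\<close>
    define m where "m = (r - k + h' - 1) div h'"
    define s where "s = m * h'"
    have "s = r - k + h' - 1 - (r - k + h' - 1) mod h'"
      by (simp add: s_def m_def minus_mod_eq_div_mult)
    moreover have "0 \<le> (r - k + h' - 1) mod h'" "(r - k + h' - 1) mod h' < h'"
      using h'(1) by simp_all
    ultimately have s: "r - k \<le> s" "s \<le> r - k + h' - 1" by linarith+
    have m0: "0 \<le> m" unfolding m_def using h' k by (intro div_int_pos_iff[THEN iffD2]) auto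
    have s3: "s \<le> r - 3" using s h' k by linarith
    have "k * lam $ i \<le> m * lam $ j + (k + s - r) * lam $ i"
      using exchange[of m "k + s - r" "1 - m"] m0 s(1) by (simp add: s_def h'_def algebra_simps)
    then have "(r - s) * lam $ i \<le> m * lam $ j" by (simp add: algebra_simps)
    then have "real_of_int h' * ((r - s) * lam $ i) \<le> h' * (m * lam $ j)"
      using h'(1) by (intro mult_left_mono) auto
    then have *: "(r - s) * (h' * lam $ i) \<le> s * lam $ j"
      by (simp add: s_def algebra_simps)
    have "3 * (h' * lam $ i) \<le> (r - s) * (h' * lam $ i)"
      using s3 h'(1) lam[of i] by (intro mult_right_mono) (auto intro!: mult_nonneg_nonneg simp flip: of_int_diff)
    also note *
    also have "s * lam $ j \<le> (r - 3) * lam $ j"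
      using s3 lam[of j] by (intro mult_right_mono) auto
    finally have le: "h' * lam $ i \<le> (real_of_int r / 3 - 1) * lam $ j"
      by (simp add: algebra_simps)
    show thesis
    proof (rule that[of "g - r"])
      have "axis j 1 - axis i g + axis i r \<in> L" by (rule add_mem[OF g(3) r])
      moreover have "axis j 1 - axis i g + axis i r = axis j 1 - axis i (g - r)"
        by (simp add: vec_eq_iff axis_def)
      ultimately show "axis j 1 - axis i (g - r) \<in> L" by simp
      have "real_of_int (g - r) * lam $ i \<le> 0"
        using g(2) lam[of i] by (intro mult_nonpos_nonneg) auto
      then show "real_of_int (g - r) * lam $ i \<le> lam $ j" using lam[of j] by linarith
      have "(real_of_int r / 3 - 1) * lam $ j \<le> max 0 (real_of_int r / 3 - 1) * lam $ j"
        using lam[of j] by (intro mult_right_mono) auto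
      with le show "- real_of_int (g - r) * lam $ i \<le> max 0 (real_of_int r / 3 - 1) * lam $ j"
        by (simp add: h'_def)
    qed
  qed
qed

text \<open>
  The bounds \<open>- c lam \<le> u \<le> d lam\<close> say that \<open>u\<close> ranges over an interval of length at most
  \<open>(c + d) \<beta>\<close> on \<open>{y. 0 \<le> y \<and> lam \<bullet> y \<le> \<beta>}\<close>; integrality on \<open>L\<close> makes \<open>u\<close> a lattice direction. When the
  extremal representative has coordinate sum at most \<open>\<delta> div 2\<close>, a unit vector serves as \<open>u\<close>. Otherwise
  \<open>u = h / r\<close>, where \<open>h\<^sub>j\<close> is the multiple of \<open>e\<^sub>i\<close> to which \<open>e\<^sub>j\<close> is congruent.
\<close>

lemma short_dual_vector:
  fixes lam :: "real^'n" and \<beta> :: real and b :: "int^'n"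
  assumes lam: "\<And>i. 0 < lam $ i" and "0 < \<beta>"
    and free: "\<And>y. 0 \<le> y \<Longrightarrow> b - y \<in> L \<Longrightarrow> \<beta> < lam \<bullet> real_vec y"
  obtains u :: "real^'n" and c d :: real
  where "u \<noteq> 0" "\<And>t. t \<in> L \<Longrightarrow> u \<bullet> real_vec t \<in> \<int>" "0 \<le> c" "0 \<le> d"
    "\<And>i. - c * lam $ i \<le> u $ i" "\<And>i. u $ i \<le> d * lam $ i"
    "(c + d) * \<beta> < real_of_int (\<delta> div 2)"
proof -
  obtain y where y: "0 \<le> y" "b - y \<in> L"
    and min: "\<And>y'. 0 \<le> y' \<Longrightarrow> b - y' \<in> L \<Longrightarrow> lam \<bullet> real_vec y \<le> lam \<bullet> real_vec y'"
    and extr: "\<And>d. d \<in> L \<Longrightarrow> (\<And>i. \<bar>d $ i\<bar> \<le> y $ i) \<Longrightarrow> d = 0"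
    using extremal_representative[OF lam] by metis
  have \<beta>_less: "\<beta> < lam \<bullet> real_vec y" using free y by blast
  show thesis
  proof (cases "\<delta> div 2 < (\<Sum>i\<in>UNIV. y $ i)")
    case False
    obtain i where i: "\<And>j. lam $ j \<le> lam $ i"
    proof -
      have "Max (range (($) lam)) \<in> range (($) lam)" by (intro Max_in) auto
      then obtain i where "Max (range (($) lam)) = lam $ i" by blast
      then have "lam $ j \<le> lam $ i" for j by (metis Max_ge finite finite_imageI rangeI)
      then show thesis using that by blast
    qed
    note \<beta>_less
    also have "lam \<bullet> real_vec y \<le> (\<Sum>j\<in>UNIV. lam $ i * real_of_int (y $ j))"
      unfolding inner_vec_def using i y(1)
      by (intro sum_mono) (auto simp: less_eq_vec_def real_vec_def intro!: mult_right_mono)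
    also have "\<dots> = lam $ i * (\<Sum>j\<in>UNIV. y $ j)"
      by (simp add: sum_distrib_left)
    also have "\<dots> \<le> lam $ i * real_of_int (\<delta> div 2)"
      using False lam[of i] by (intro mult_left_mono) (auto simp del: of_int_sum)
    finally have "\<beta> / lam $ i < real_of_int (\<delta> div 2)"
      using lam[of i] by (simp add: pos_divide_less_eq mult.commute)
    moreover have "axis i 1 \<bullet> real_vec t \<in> \<int>" for t :: "int^'n"
      by (simp add: inner_axis' real_vec_def)
    moreover have "- 0 * lam $ j \<le> axis i 1 $ j" "axis i 1 $ j \<le> 1 / lam $ i * lam $ j" for j
      using lam[of i] lam[of j] by (auto simp: axis_def)
    moreover have "(axis i 1 :: real^'n) \<noteq> 0" by (simp add: axis_eq_0_iff)
    ultimately show thesis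
      using lam[of i] by (intro that[of "axis i 1" 0 "1 / lam $ i"]) auto
  next
    case True
    from concentrated[OF y(1) extr this] obtain i k where yk: "y = axis i k" and k: "\<delta> div 2 < k"
      by metis
    from cyclic_quotient[of i k] extr yk k
    obtain r where r: "k < r" "r \<le> \<delta>" "axis i r \<in> L" and dvd: "\<And>m. axis i m \<in> L \<Longrightarrow> r dvd m"
      and gen: "\<And>j. \<exists>g. 0 \<le> g \<and> g < r \<and> axis j 1 - axis i g \<in> L"
      by metis
    have w_y: "lam \<bullet> real_vec y = k * lam $ i"
    proof -
      have "real_vec y = real_of_int k *\<^sub>R axis i 1"
        by (simp add: yk vec_eq_iff real_vec_def axis_def)
      then show ?thesis by (simp add: inner_axis)
    qed
    have min': "k * lam $ i \<le> lam \<bullet> real_vec y'" if "0 \<le> y'" "axis i k - y' \<in> L" for y'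
    proof -
      have "b - y' \<in> L" using add_mem[OF y(2) that(2)] by (simp add: yk)
      with min that(1) w_y show ?thesis by metis
    qed
    have r2: "r < 2 * k" using r(2) k by presburger
    have "\<exists>h. axis j 1 - axis i h \<in> L \<and> real_of_int h * lam $ i \<le> lam $ j \<and>
        - real_of_int h * lam $ i \<le> max 0 (real_of_int r / 3 - 1) * lam $ j" for j
    proof -
      obtain g where "0 \<le> g" "g < r" "axis j 1 - axis i g \<in> L" using gen by blast
      from coordinate_coefficient[OF lam min' r(1) r2 r(3) this] show ?thesis by metis
    qed
    then obtain h where h: "\<And>j. axis j 1 - axis i (h j) \<in> L"
      "\<And>j. real_of_int (h j) * lam $ i \<le> lam $ j"
      "\<And>j. - real_of_int (h j) * lam $ i \<le> max 0 (real_of_int r / 3 - 1) * lam $ j"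
      by metis
    have r_pos: "0 < r" and k_pos: "0 < k" and k1: "1 \<le> \<delta> div 2" using r k by linarith+
    define u :: "real^'n" where "u = (\<chi> j. h j / r)"
    define d where "d = 1 / (r * lam $ i)"
    define c where "c = max 0 (real_of_int r / 3 - 1) / (r * lam $ i)"
    have den: "0 < r * lam $ i" using r_pos lam by simp
    have integral: "u \<bullet> real_vec t \<in> \<int>" if "t \<in> L" for t
    proof -
      \<comment> \<open>Modulo \<open>L\<close>, the vector \<open>t\<close> equals \<open>(\<Sum>t\<^sub>j h\<^sub>j) e\<^sub>i\<close>; as \<open>t\<close> lies in \<open>L\<close>, the order \<open>r\<close> divides
        the coefficient.\<close>
      have mem: "(\<Sum>j\<in>UNIV. t $ j *s (axis j 1 - axis i (h j))) \<in> L"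
        by (intro sum_mem smult_mem h)
      have eq: "t - (\<Sum>j\<in>UNIV. t $ j *s (axis j 1 - axis i (h j))) = axis i (\<Sum>j\<in>UNIV. t $ j * h j)"
      proof -
        have "(\<Sum>j\<in>UNIV. t $ j * axis j 1 $ l) = t $ l" for l
        proof -
          have "(\<Sum>j\<in>UNIV. t $ j * axis j 1 $ l) = (\<Sum>j\<in>UNIV. if l = j then t $ j else 0)"
            by (rule sum.cong) (auto simp: axis_def)
          then show ?thesis by simp
        qed
        moreover have "(\<Sum>j\<in>UNIV. t $ j * axis i (h j) $ l) = axis i (\<Sum>j\<in>UNIV. t $ j * h j) $ l" for l
          by (simp add: axis_def)
        ultimately show ?thesis
          by (simp add: vec_eq_iff right_diff_distrib sum_subtractf)
      qed
      have "axis i (\<Sum>j\<in>UNIV. t $ j * h j) \<in> L"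
        using diff_mem[OF that mem] by (simp only: eq)
      then have "r dvd (\<Sum>j\<in>UNIV. t $ j * h j)" by (rule dvd)
      then obtain q where q: "(\<Sum>j\<in>UNIV. t $ j * h j) = r * q" by blast
      have "u \<bullet> real_vec t = real_of_int (\<Sum>j\<in>UNIV. t $ j * h j) / r"
        by (simp add: inner_vec_def u_def real_vec_def sum_divide_distrib mult.commute)
      also have "\<dots> = q" using r_pos by (simp add: q)
      finally show ?thesis by simp
    qed
    have "u \<noteq> 0"
    proof
      assume "u = 0"
      then have "h i = 0" using r_pos by (auto simp: u_def vec_eq_iff)
      then have "axis i 1 \<in> L" using h(1)[of i] by (simp add: axis_eq_0_iff[THEN iffD2])
      then have "r dvd 1" by (rule dvd)
      with r k_pos show False by (simp add: zdvd1_eq)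
    qed
    have upper: "u $ j \<le> d * lam $ j" for j
      using h(2)[of j] den r_pos lam[of i] by (simp add: u_def d_def field_simps)
    have lower: "- c * lam $ j \<le> u $ j" for j
    proof -
      have "- u $ j = (- real_of_int (h j) * lam $ i) / (r * lam $ i)"
        using den lam[of i] by (simp add: u_def)
      also have "\<dots> \<le> (max 0 (real_of_int r / 3 - 1) * lam $ j) / (r * lam $ i)"
        using h(3) den by (intro divide_right_mono) auto
      also have "\<dots> = c * lam $ j" by (simp add: c_def)
      finally show ?thesis by simp
    qed
    \<comment> \<open>The left-hand side is \<open>max 1 (r / 3) * k\<close>. It suffices that \<open>k < r\<close> and \<open>1 \<le> \<delta> div 2\<close> in the
      first case, and that \<open>k < \<delta>\<close> in the second.\<close>
    have spread: "(max 0 (real_of_int r / 3 - 1) + 1) * k \<le> real_of_int (\<delta> div 2) * r"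
    proof (cases "real_of_int r / 3 - 1 \<le> 0")
      case True
      have "k \<le> (\<delta> div 2) * r" using mult_mono[of 1 "\<delta> div 2" k r] k1 k_pos r by auto
      then have "real_of_int k \<le> real_of_int (\<delta> div 2) * r"
        by (simp flip: of_int_mult)
      moreover have "max 0 (real_of_int r / 3 - 1) = 0" using True by (rule max_absorb1)
      ultimately show ?thesis by (simp only: add_0 mult_1)
    next
      case False
      have "k \<le> 3 * (\<delta> div 2)" using r k1 by presburger
      then have "real_of_int k \<le> real_of_int (3 * (\<delta> div 2))" by (simp only: of_int_le_iff)
      then have "real_of_int k * r \<le> (3 * real_of_int (\<delta> div 2)) * r"
        using r_pos by (intro mult_right_mono) auto
      moreover have "max 0 (real_of_int r / 3 - 1) = real_of_int r / 3 - 1" using False by simp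
      ultimately show ?thesis by (simp add: algebra_simps)
    qed
    have c0: "0 \<le> c" and d0: "0 < d" using den by (simp_all add: c_def d_def)
    have "(c + d) * \<beta> < (c + d) * (k * lam $ i)"
      using c0 d0 \<beta>_less w_y by (intro mult_strict_left_mono) auto
    also have "\<dots> = (max 0 (real_of_int r / 3 - 1) + 1) * k / r"
      using den lam[of i] by (simp add: c_def d_def add_divide_distrib[symmetric] less_imp_neq[symmetric])
    also have "\<dots> \<le> real_of_int (\<delta> div 2)"
      using spread r_pos by (simp add: pos_divide_le_eq)
    finally show thesis
      using that[of u c d] \<open>u \<noteq> 0\<close> integral c0 d0 lower upper by auto
  qed
qed

end

section \<open>The width of the simplex\<close>

lemma index_bounded_lattice_range:
  fixes A :: "int^'n^'n"
  assumes "det A \<noteq> 0"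
  shows "index_bounded_lattice (range ((*v) A)) \<bar>det A\<bar>"
proof
  show "0 \<in> range ((*v) A)" by (metis matrix_vector_mult_0_right rangeI)
  show "s - t \<in> range ((*v) A)" if "s \<in> range ((*v) A)" "t \<in> range ((*v) A)" for s t
    using that by (auto simp flip: matrix_vector_mult_diff_distrib)
qed (rule card_incongruent_le_det[OF assms])

text \<open>
  An interior point \<open>w\<close> of the dual cone stays in it when moved a little in the direction \<open>- y\<close>.
\<close>

lemma interior_dual_cone_inner_pos:
  assumes "w \<in> interior (dual_cone C)" "y \<in> C" "y \<noteq> 0"
  shows "0 < y \<bullet> w"
proof -
  obtain e where e: "0 < e" "cball w e \<subseteq> dual_cone C"
    using assms(1) by (meson interior_subset mem_interior_cball)
  have "w - (e / norm y) *\<^sub>R y \<in> cball w e"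
    using e(1) assms(3) by (simp add: dist_norm)
  with e(2) have "w - (e / norm y) *\<^sub>R y \<in> dual_cone C" by blast
  then have "0 \<le> y \<bullet> (w - (e / norm y) *\<^sub>R y)"
    using assms(2) by (simp add: dual_cone_def)
  then have "e * norm y \<le> y \<bullet> w"
    using assms(3) by (simp add: inner_diff_right dot_square_norm power2_eq_square)
  moreover have "0 < e * norm y" using e(1) assms(3) by simp
  ultimately show ?thesis by linarith
qed

text \<open>
  The cone is generated by the columns of the inverse matrix, and \<open>lam $ i\<close> is the product of \<open>w\<close> with
  the \<open>i\<close>-th of them.
\<close>

lemma facet_multipliers:
  fixes A :: "int^'n^'n" and w :: "real^'n"
  assumes "invertible (real_mat A)" "w \<in> interior (dual_cone (ineq_cone A))"
  obtains lam where "w = lam v* real_mat A" "\<And>i. 0 < lam $ i"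
proof -
  obtain R' where R': "real_mat A ** R' = mat 1" "R' ** real_mat A = mat 1"
    using assms(1) unfolding invertible_def by blast
  define lam where "lam = w v* R'"
  have "0 < lam $ i" for i
  proof -
    have R'i: "real_mat A *v (R' *v axis i 1) = axis i 1"
      by (simp add: matrix_vector_mul_assoc R')
    have "R' *v axis i 1 \<in> ineq_cone A"
      unfolding ineq_cone_def mem_Collect_eq R'i by (simp add: less_eq_vec_def axis_def)
    moreover have "R' *v axis i 1 \<noteq> 0"
    proof
      assume "R' *v axis i 1 = 0"
      with R'i show False by (simp add: axis_eq_0_iff)
    qed
    ultimately have "0 < (R' *v axis i 1) \<bullet> w"
      using interior_dual_cone_inner_pos[OF assms(2)] by blast
    also have "(R' *v axis i 1) \<bullet> w = lam \<bullet> axis i 1"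
      by (metis dot_lmul_matrix inner_commute lam_def)
    finally show ?thesis by (simp add: inner_axis)
  qed
  moreover have "w = lam v* real_mat A"
    by (simp add: lam_def vector_matrix_mul_assoc R')
  ultimately show thesis using that by blast
qed

text \<open>
  In the slack coordinates \<open>y = b - A x\<close> the functional is \<open>\<mu> - u \<bullet> y\<close>, and \<open>u \<bullet> y\<close> is compared with
  \<open>lam \<bullet> y \<le> \<beta>\<close> coordinatewise.
\<close>

lemma simplex_inner_bounds:
  fixes A :: "int^'n^'n" and lam u v x :: "real^'n"
  assumes v: "real_mat A *v v = real_vec b"
    and a: "- real_vec a = lam v* real_mat A"
    and lam: "\<And>i. 0 < lam $ i"
    and cd: "0 \<le> c" "0 \<le> d" "\<And>i. - c * lam $ i \<le> u $ i" "\<And>i. u $ i \<le> d * lam $ i"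
    and x: "x \<in> simplex_P A a b ba"
  defines "\<beta> \<equiv> real_of_int ba - real_vec a \<bullet> v" and "\<mu> \<equiv> u \<bullet> real_vec b"
  shows "(u v* real_mat A) \<bullet> x \<in> {\<mu> - d * \<beta>..\<mu> + c * \<beta>}"
proof -
  define y where "y = real_vec b - real_mat A *v x"
  have y0: "0 \<le> y $ i" for i
    using x by (simp add: simplex_P_def y_def less_eq_vec_def)
  have "lam \<bullet> y = (lam v* real_mat A) \<bullet> v - (lam v* real_mat A) \<bullet> x"
    by (simp add: y_def inner_diff_right dot_lmul_matrix v)
  also have "\<dots> \<le> \<beta>"
    using x by (simp add: a[symmetric] simplex_P_def \<beta>_def)
  finally have lam_y: "lam \<bullet> y \<le> \<beta>" .
  have "u \<bullet> y \<le> d * (lam \<bullet> y)"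
    unfolding inner_vec_def sum_distrib_left using y0 cd
    by (intro sum_mono) (auto simp flip: mult.assoc intro: mult_right_mono)
  also have "\<dots> \<le> d * \<beta>" using lam_y cd by (intro mult_left_mono) auto
  finally have up: "u \<bullet> y \<le> d * \<beta>" .
  have "- (u \<bullet> y) \<le> c * (lam \<bullet> y)"
  proof -
    have "- (u $ i * y $ i) \<le> c * (lam $ i * y $ i)" for i
      using mult_right_mono[OF cd(3)[of i] y0[of i]] by simp
    then show ?thesis
      unfolding inner_vec_def sum_distrib_left sum_negf[symmetric] by (auto intro: sum_mono)
  qed
  also have "\<dots> \<le> c * \<beta>" using lam_y cd by (intro mult_left_mono) auto
  finally have lo: "- (u \<bullet> y) \<le> c * \<beta>" .
  have "(u v* real_mat A) \<bullet> x = \<mu> - u \<bullet> y"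
    by (simp add: dot_lmul_matrix y_def inner_diff_right \<mu>_def)
  with up lo show ?thesis by simp
qed

lemma width_along_le:
  assumes "P \<noteq> {}" and bounds: "\<And>x. x \<in> P \<Longrightarrow> z \<bullet> x \<in> {l..h}"
  shows "width_along P z \<le> h - l" and "0 \<le> width_along P z"
proof -
  have "(SUP x\<in>P. z \<bullet> x) \<le> h" "l \<le> (INF x\<in>P. z \<bullet> x)"
    using assms by (auto intro!: cSUP_least cINF_greatest)
  then show "width_along P z \<le> h - l" by (simp add: width_along_def)
  obtain x where x: "x \<in> P" using assms(1) by blast
  have "bdd_above ((\<bullet>) z ` P)" "bdd_below ((\<bullet>) z ` P)"
    using bounds by (auto intro!: bdd_aboveI2[of _ _ h] bdd_belowI2[of _ l])
  then have "z \<bullet> x \<le> (SUP x\<in>P. z \<bullet> x)" "(INF x\<in>P. z \<bullet> x) \<le> z \<bullet> x"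
    using x by (auto intro: cSUP_upper cINF_lower)
  then show "0 \<le> width_along P z" by (simp add: width_along_def)
qed

theorem theorem1p4:
  fixes A :: "int^'n^'n" and a b :: "int^'n" and ba \<delta> :: int and v :: "real^'n"
  assumes "invertible (real_mat A)"
    and "real_mat A *v v = real_vec b"
    and "- real_vec a \<in> interior (dual_cone (ineq_cone A))"
    and "real_of_int ba > real_vec a \<bullet> v"
    and "lattice_free (simplex_P A a b ba)"
    and "\<delta> = min_subdet (append_row A a)"
    and "\<bar>det A\<bar> = \<delta>"
  shows "lattice_width (simplex_P A a b ba) < real_of_int \<lfloor>real_of_int \<delta> / 2\<rfloor>"
proof -
  let ?P = "simplex_P A a b ba" and ?R = "real_mat A"
  define \<beta> where "\<beta> = real_of_int ba - real_vec a \<bullet> v"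
  have \<beta>: "0 < \<beta>" using assms(4) by (simp add: \<beta>_def)
  have "det A \<noteq> 0" using assms(1) by (simp add: invertible_det_nz det_real_mat)
  then interpret index_bounded_lattice "range ((*v) A)" \<delta>
    using index_bounded_lattice_range assms(7) by blast
  obtain R' where R': "?R ** R' = mat 1" "R' ** ?R = mat 1"
    using assms(1) unfolding invertible_def by blast
  obtain lam where a: "- real_vec a = lam v* ?R" and lam: "\<And>i. 0 < lam $ i"
    using facet_multipliers[OF assms(1,3)] by blast
  have "v \<in> ?P" using assms(2,4) by (simp add: simplex_P_def)
  then have P_ne: "?P \<noteq> {}" by blast
  have free: "\<beta> < lam \<bullet> real_vec y" if y0: "0 \<le> y" and mem: "b - y \<in> range ((*v) A)" for y
  proof -
    obtain x where "b - y = A *v x" using mem by blast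
    then have y: "y = b - A *v x" by (simp add: algebra_simps)
    have "?R *v real_vec x \<le> real_vec b"
      using y0 by (simp add: y less_eq_vec_def flip: real_vec_matrix_vector_mult)
    moreover have "real_vec x \<notin> ?P" using assms(5) by (auto simp: lattice_free_def)
    ultimately have "ba < real_vec a \<bullet> real_vec x" by (auto simp: simplex_P_def)
    moreover have "lam \<bullet> real_vec y = (lam v* ?R) \<bullet> v - (lam v* ?R) \<bullet> real_vec x"
      by (simp add: y real_vec_diff real_vec_matrix_vector_mult inner_diff_right dot_lmul_matrix assms(2))
    ultimately show ?thesis by (simp add: a[symmetric] \<beta>_def)
  qed
  obtain u c d where u: "u \<noteq> 0" "\<And>t. t \<in> range ((*v) A) \<Longrightarrow> u \<bullet> real_vec t \<in> \<int>"
    and cd: "0 \<le> c" "0 \<le> d" "\<And>i. - c * lam $ i \<le> u $ i" "\<And>i. u $ i \<le> d * lam $ i"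
    and small: "(c + d) * \<beta> < real_of_int (\<delta> div 2)"
    using short_dual_vector[of lam \<beta> b, OF lam \<beta> free] by blast
  define z where "z = floor_vec (u v* ?R)"
  have z: "real_vec z = u v* ?R"
  proof -
    have "(u v* ?R) $ i \<in> \<int>" for i
    proof -
      have "(u v* ?R) $ i = (u v* ?R) \<bullet> real_vec (axis i 1)"
        by (simp add: inner_axis real_vec_def axis_def inner_vec_def if_distrib cong: if_cong)
      also have "\<dots> = u \<bullet> real_vec (A *v axis i 1)"
        by (simp add: dot_lmul_matrix real_vec_matrix_vector_mult)
      also have "\<dots> \<in> \<int>" using u(2) by blast
      finally show ?thesis .
    qed
    then show ?thesis by (simp add: z_def vec_eq_iff)
  qed
  have "z \<noteq> 0"
  proof
    assume "z = 0"
    then have "u v* ?R = 0" using z by (simp add: vec_eq_iff real_vec_def)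
    then have "(u v* ?R) v* R' = 0" by simp
    then have "u = 0" by (simp add: vector_matrix_mul_assoc R')
    with u(1) show False by simp
  qed
  \<comment> \<open>Every functional is bounded on the simplex, as some multiple of \<open>lam\<close> dominates its coefficients;
    so the infimum that defines the lattice width is over a set bounded below by 0.\<close>
  have width_nonneg: "0 \<le> width_along ?P w" for w
  proof -
    define U where "U = w v* R'"
    define c where "c = (\<Sum>i\<in>UNIV. \<bar>U $ i\<bar> / lam $ i)"
    have c: "\<bar>U $ i\<bar> \<le> c * lam $ i" for i
    proof -
      have "\<bar>U $ i\<bar> / lam $ i \<le> c"
        unfolding c_def using lam by (intro member_le_sum) (auto simp: less_imp_le)
      then show ?thesis using lam by (simp add: pos_divide_le_eq)
    qed
    have "0 \<le> c" unfolding c_def using lam by (intro sum_nonneg) (auto simp: less_imp_le)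
    moreover have "- c * lam $ i \<le> U $ i" "U $ i \<le> c * lam $ i" for i
      using c[of i] by auto
    moreover have "w = U v* ?R"
      by (simp add: U_def vector_matrix_mul_assoc R')
    ultimately show ?thesis
      using width_along_le(2)[OF P_ne] simplex_inner_bounds[OF assms(2) a lam, of c c U] by metis
  qed
  have "lattice_width ?P \<le> width_along ?P (real_vec z)"
    unfolding lattice_width_def using \<open>z \<noteq> 0\<close> width_nonneg
    by (intro cINF_lower bdd_belowI2[of _ 0]) auto
  also have "\<dots> \<le> (u \<bullet> real_vec b + c * \<beta>) - (u \<bullet> real_vec b - d * \<beta>)"
    unfolding z \<beta>_def
    by (rule width_along_le(1)[OF P_ne simplex_inner_bounds[OF assms(2) a lam cd]])
  also have "\<dots> = (c + d) * \<beta>" by (simp add: algebra_simps)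
  also note small
  also have "real_of_int (\<delta> div 2) = real_of_int \<lfloor>real_of_int \<delta> / 2\<rfloor>"
    by (simp add: floor_divide_of_int_eq[of \<delta> 2, simplified])
  finally show ?thesis .
qed

end
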